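(* Let $N\ge 1$ be an integer, $\rho>1$, and $\theta_s=2\pi s/N$ for $s=1,\dots,N$ (circular full-view setting). For an integer $K\geq 1$, let $\mathbf{L}_K:\mathbb{R}^{2K\times 2K}\to\mathbb{R}^{N\times N}$, $\mathbf{L}_K(\mathbf{M})=\mathbf{C}_K\mathbf{D}_K\mathbf{M}\mathbf{D}_K\mathbf{C}_K^\top$, be the linear operator for order $K$ defined in the context. Then for any orders $1\le K_1\le K_2<N/2$ and any $\mathbf{V}\in\mathbb{R}^{N\times N}$, the submatrix of $\mathbf{L}_{K_2}^\dagger(\mathbf{V})$ formed by the first $2K_1$ columns and rows is identical to the minimal norm solution $\mathbf{L}_{K_1}^\dagger(\mathbf{V})$.
   Context: $\mathbf{C}_K$ is the real $N\times 2K$ matrix made of $1\times 2$ blocks $(\mathbf{C}_K)_{rm}=(\cos m\theta_r,\ \sin m\theta_r)$, $r=1,\dots,N$, $m=1,\dots,K$. $\mathbf{D}_K$ is the $2K\times 2K$ block-diagonal matrix $\mathbf{D}_K=\frac{1}{2\pi}\,\mathrm{diag}\big(\mathbf{I}_2/\rho,\ \mathbf{I}_2/(2\rho^2),\ \dots,\ \mathbf{I}_2/(K\rho^K)\big)$, where $\mathbf{I}_2$ is the $2\times 2$ identity matrix. $\mathbf{L}_K^\dagger$ is the Moore–Penrose pseudo-inverse of $\mathbf{L}_K$ with respect to the Frobenius inner products; $\mathbf{L}_K^\dagger(\mathbf{V})$ is the minimal Frobenius norm solution of the least-squares problem $\min_{\mathbf{M}\in\mathbb{R}^{2K\times 2K}}\|\mathbf{L}_K(\mathbf{M})-\mathbf{V}\|_F^2$.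 *)

theory Defs
  imports Complex_Main "HOL-Library.FuncSet" "Jordan_Normal_Form.DL_Submatrix"
begin

section \<open>Frobenius geometry and least squares for linear matrix operators\<close>

definition frob_inner :: "real mat \<Rightarrow> real mat \<Rightarrow> real" where
  "frob_inner A B = (\<Sum>i<dim_row A. \<Sum>j<dim_col A. A $$ (i,j) * B $$ (i,j))"

definition frob_norm :: "real mat \<Rightarrow> real" where
  "frob_norm A = sqrt (frob_inner A A)"

text \<open>In what follows an operator takes \<open>p \<times> q\<close> matrices to \<open>n \<times> m\<close> matrices.\<close>

definition mat_linear :: "nat \<Rightarrow> nat \<Rightarrow> nat \<Rightarrow> nat \<Rightarrow> (real mat \<Rightarrow> real mat) \<Rightarrow> bool" where
  "mat_linear p q n m f \<longleftrightarrow>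
     f \<in> carrier_mat p q \<rightarrow> carrier_mat n m \<and>
     (\<forall>A\<in>carrier_mat p q. \<forall>B\<in>carrier_mat p q. f (A + B) = f A + f B) \<and>
     (\<forall>c. \<forall>A\<in>carrier_mat p q. f (c \<cdot>\<^sub>m A) = c \<cdot>\<^sub>m f A)"

definition self_adjoint_op :: "nat \<Rightarrow> nat \<Rightarrow> (real mat \<Rightarrow> real mat) \<Rightarrow> bool" where
  "self_adjoint_op p q h \<longleftrightarrow>
     (\<forall>X\<in>carrier_mat p q. \<forall>Y\<in>carrier_mat p q. frob_inner (h X) Y = frob_inner X (h Y))"

text \<open>The four Penrose conditions, with adjoints taken for the Frobenius inner products.\<close>

definition is_mp_inverse ::
    "nat \<Rightarrow> nat \<Rightarrow> nat \<Rightarrow> nat \<Rightarrow> (real mat \<Rightarrow> real mat) \<Rightarrow> (real mat \<Rightarrow> real mat) \<Rightarrow> bool" where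
  "is_mp_inverse p q n m f g \<longleftrightarrow>
     mat_linear n m p q g \<and>
     (\<forall>X\<in>carrier_mat p q. f (g (f X)) = f X) \<and>
     (\<forall>Y\<in>carrier_mat n m. g (f (g Y)) = g Y) \<and>
     self_adjoint_op n m (\<lambda>Y. f (g Y)) \<and>
     self_adjoint_op p q (\<lambda>X. g (f X))"

text \<open>Extensionality off \<open>carrier_mat n m\<close> is what makes the operator unique as a HOL function.\<close>

definition mp_inverse ::
    "nat \<Rightarrow> nat \<Rightarrow> nat \<Rightarrow> nat \<Rightarrow> (real mat \<Rightarrow> real mat) \<Rightarrow> real mat \<Rightarrow> real mat" where
  "mp_inverse p q n m f =
     (THE g. g \<in> extensional (carrier_mat n m) \<and> is_mp_inverse p q n m f g)"

definition least_squares_solution ::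
    "nat \<Rightarrow> nat \<Rightarrow> (real mat \<Rightarrow> real mat) \<Rightarrow> real mat \<Rightarrow> real mat \<Rightarrow> bool" where
  "least_squares_solution p q f V M \<longleftrightarrow>
     M \<in> carrier_mat p q \<and>
     (\<forall>X\<in>carrier_mat p q. (frob_norm (f M - V))\<^sup>2 \<le> (frob_norm (f X - V))\<^sup>2)"

definition min_norm_solution ::
    "nat \<Rightarrow> nat \<Rightarrow> (real mat \<Rightarrow> real mat) \<Rightarrow> real mat \<Rightarrow> real mat \<Rightarrow> bool" where
  "min_norm_solution p q f V M \<longleftrightarrow>
     least_squares_solution p q f V M \<and>
     (\<forall>X. least_squares_solution p q f V X \<longrightarrow> frob_norm M \<le> frob_norm X)"

lemma frob_inner_commute:
  assumes "A \<in> carrier_mat p q" "B \<in> carrier_mat p q"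
  shows "frob_inner A B = frob_inner B A"
  using assms by (simp add: frob_inner_def mult.commute)

lemma frob_inner_diff_right:
  assumes "A \<in> carrier_mat p q" "B \<in> carrier_mat p q" "C \<in> carrier_mat p q"
  shows "frob_inner A (B - C) = frob_inner A B - frob_inner A C"
  using assms by (simp add: frob_inner_def sum_subtractf right_diff_distrib)

lemma frob_inner_diff_left:
  assumes "A \<in> carrier_mat p q" "B \<in> carrier_mat p q" "C \<in> carrier_mat p q"
  shows "frob_inner (A - B) C = frob_inner A C - frob_inner B C"
  using assms by (simp add: frob_inner_def sum_subtractf left_diff_distrib)

lemma frob_inner_nonneg: "frob_inner A A \<ge> 0"
  by (simp add: frob_inner_def sum_nonneg)

lemma frob_norm_power2: "(frob_norm A)\<^sup>2 = frob_inner A A"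
  by (simp add: frob_norm_def frob_inner_nonneg)

lemma frob_inner_diff_zero:
  assumes A: "A \<in> carrier_mat p q" and B: "B \<in> carrier_mat p q"
    and 0: "frob_inner (A - B) (A - B) = 0"
  shows "A = B"
proof (rule eq_matI)
  fix i j assume ij: "i < dim_row B" "j < dim_col B"
  have "(\<Sum>i<p. \<Sum>j<q. (A $$ (i,j) - B $$ (i,j)) * (A $$ (i,j) - B $$ (i,j))) = 0"
    using A B 0 by (simp add: frob_inner_def)
  then show "A $$ (i,j) = B $$ (i,j)"
    using ij B by (simp add: sum_nonneg_eq_0_iff sum_nonneg)
qed (use A B in auto)

lemma frob_inner_ext:
  assumes A: "A \<in> carrier_mat p q" and B: "B \<in> carrier_mat p q"
    and eq: "\<And>Y. Y \<in> carrier_mat p q \<Longrightarrow> frob_inner A Y = frob_inner B Y"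
  shows "A = B"
proof (rule frob_inner_diff_zero[OF A B])
  have "A - B \<in> carrier_mat p q" using A B by auto
  then show "frob_inner (A - B) (A - B) = 0"
    by (simp add: frob_inner_diff_left[OF A B] eq)
qed

lemma is_mp_inverse_unique:
  assumes f: "f \<in> carrier_mat p q \<rightarrow> carrier_mat n m"
    and g: "is_mp_inverse p q n m f g" and h: "is_mp_inverse p q n m f h"
    and V: "V \<in> carrier_mat n m"
  shows "g V = h V"
proof -
  have fc: "\<And>X. X \<in> carrier_mat p q \<Longrightarrow> f X \<in> carrier_mat n m" using f by auto
  have gc: "\<And>X. X \<in> carrier_mat n m \<Longrightarrow> g X \<in> carrier_mat p q"
    and hc: "\<And>X. X \<in> carrier_mat n m \<Longrightarrow> h X \<in> carrier_mat p q"
    using g h by (auto simp: is_mp_inverse_def mat_linear_def)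
  note gd = g[unfolded is_mp_inverse_def self_adjoint_op_def]
  note hd = h[unfolded is_mp_inverse_def self_adjoint_op_def]
  have 1: "f (g X) = f (h X)" if X: "X \<in> carrier_mat n m" for X
  proof (rule frob_inner_ext)
    fix Y :: "real mat" assume Y: "Y \<in> carrier_mat n m"
    have "frob_inner (f (g X)) Y = frob_inner (f (h (f (g X)))) Y"
      using hd gc X by simp
    also have "\<dots> = frob_inner (f (g X)) (f (h Y))" using hd Y fc gc X by blast
    also have "\<dots> = frob_inner X (f (g (f (h Y))))" using gd Y fc hc X by blast
    also have "\<dots> = frob_inner X (f (h Y))" using gd hc Y by simp
    also have "\<dots> = frob_inner (f (h X)) Y" using hd X Y by simp
    finally show "frob_inner (f (g X)) Y = frob_inner (f (h X)) Y" .
  qed (use fc gc hc X in auto)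
  have 2: "g (f X) = h (f X)" if X: "X \<in> carrier_mat p q" for X
  proof (rule frob_inner_ext)
    fix Y :: "real mat" assume Y: "Y \<in> carrier_mat p q"
    have "frob_inner (g (f X)) Y = frob_inner (g (f (h (f X)))) Y"
      using hd X by simp
    also have "\<dots> = frob_inner (h (f X)) (g (f Y))" using gd Y fc hc X by blast
    also have "\<dots> = frob_inner X (h (f (g (f Y))))" using hd Y fc gc X by blast
    also have "\<dots> = frob_inner X (h (f Y))" using gd Y by simp
    also have "\<dots> = frob_inner (h (f X)) Y" using hd X Y by simp
    finally show "frob_inner (g (f X)) Y = frob_inner (h (f X)) Y" .
  qed (use fc gc hc X in auto)
  have "g V = g (f (g V))" using gd V by simp
  also have "\<dots> = g (f (h V))" using 1 V by simp
  also have "\<dots> = h (f (h V))" using 2 hc V by simp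
  also have "\<dots> = h V" using hd V by simp
  finally show ?thesis .
qed

lemma mp_inverse_eqI:
  assumes f: "f \<in> carrier_mat p q \<rightarrow> carrier_mat n m"
    and g: "is_mp_inverse p q n m f g" and V: "V \<in> carrier_mat n m"
  shows "mp_inverse p q n m f V = g V"
proof -
  let ?g = "restrict g (carrier_mat n m)"
  have "is_mp_inverse p q n m f ?g"
    using f g by (auto simp: is_mp_inverse_def mat_linear_def self_adjoint_op_def Pi_iff)
  then have "mp_inverse p q n m f = ?g"
    unfolding mp_inverse_def
    by (intro the_equality conjI restrict_extensional)
      (auto intro!: extensionalityI[where A = "carrier_mat n m"] dest: is_mp_inverse_unique[OF f])
  then show ?thesis using V by simp
qed

lemma min_norm_solution_iff_mp_inverse:
  assumes f: "mat_linear p q n m f"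
    and g: "is_mp_inverse p q n m f g" and V: "V \<in> carrier_mat n m"
  shows "min_norm_solution p q f V M \<longleftrightarrow> M = mp_inverse p q n m f V"
proof -
  have fc: "\<And>X. X \<in> carrier_mat p q \<Longrightarrow> f X \<in> carrier_mat n m"
    using f by (auto simp: mat_linear_def)
  have gc: "\<And>X. X \<in> carrier_mat n m \<Longrightarrow> g X \<in> carrier_mat p q"
    using g by (auto simp: is_mp_inverse_def mat_linear_def)
  note gd = g[unfolded is_mp_inverse_def self_adjoint_op_def]
  define G where "G = g V"
  have G: "G \<in> carrier_mat p q" using gc V by (simp add: G_def)
  have gfG: "g (f G) = G" using gd V by (simp add: G_def)
  have orth: "frob_inner (f X) (f G) = frob_inner (f X) V" if X: "X \<in> carrier_mat p q" for X
  proof -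
    have "frob_inner (f (g (f X))) V = frob_inner (f X) (f (g V))" using gd fc X V by blast
    then show ?thesis using gd X by (simp add: G_def)
  qed
  have res: "frob_inner (f X - V) (f X - V)
      = frob_inner (f X - f G) (f X - f G) + frob_inner (f G - V) (f G - V)"
    if X: "X \<in> carrier_mat p q" for X
  proof -
    note [simp] = frob_inner_diff_left[where p = n and q = m]
        frob_inner_diff_right[where p = n and q = m] minus_carrier_mat
    have "frob_inner (f G) (f X) = frob_inner (f X) V" "frob_inner V (f X) = frob_inner (f X) V"
      "frob_inner V (f G) = frob_inner (f G) V"
      using orth[OF X] frob_inner_commute fc X G V by metis+
    then show ?thesis using fc X G V orth[OF X] orth[OF G] by simp
  qed
  have lsq: "least_squares_solution p q f V X \<longleftrightarrow> X \<in> carrier_mat p q \<and> f X = f G" for X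
  proof
    assume L: "least_squares_solution p q f V X"
    then have X: "X \<in> carrier_mat p q" by (simp add: least_squares_solution_def)
    have "frob_inner (f X - V) (f X - V) \<le> frob_inner (f G - V) (f G - V)"
      using L G by (simp add: least_squares_solution_def frob_norm_power2)
    then have "frob_inner (f X - f G) (f X - f G) = 0"
      using res[OF X] frob_inner_nonneg[of "f X - f G"] by simp
    then show "X \<in> carrier_mat p q \<and> f X = f G"
      using X frob_inner_diff_zero fc G by blast
  next
    assume "X \<in> carrier_mat p q \<and> f X = f G"
    then show "least_squares_solution p q f V X"
      by (simp add: least_squares_solution_def frob_norm_power2 res frob_inner_nonneg)
  qed
  have pyth: "frob_inner X X = frob_inner (X - G) (X - G) + frob_inner G G"
    if X: "X \<in> carrier_mat p q" "f X = f G" for X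
  proof -
    note [simp] = frob_inner_diff_left[where p = p and q = q]
        frob_inner_diff_right[where p = p and q = q] minus_carrier_mat
    have "frob_inner G X = frob_inner (g (f G)) X" by (simp add: gfG)
    also have "\<dots> = frob_inner G (g (f X))" using gd G X by simp
    finally have "frob_inner G X = frob_inner G G" by (simp add: X gfG)
    moreover have "frob_inner X G = frob_inner G X" using frob_inner_commute X G by blast
    ultimately show ?thesis using X G by simp
  qed
  have "min_norm_solution p q f V M \<longleftrightarrow> M = G"
  proof
    assume M: "min_norm_solution p q f V M"
    then have Mc: "M \<in> carrier_mat p q" "f M = f G" by (auto simp: min_norm_solution_def lsq)
    have "frob_norm M \<le> frob_norm G" using M G by (simp add: min_norm_solution_def lsq)
    then have "frob_inner M M \<le> frob_inner G G" by (simp add: frob_norm_def)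
    then have "frob_inner (M - G) (M - G) = 0"
      using pyth[OF Mc] frob_inner_nonneg[of "M - G"] by simp
    then show "M = G" using frob_inner_diff_zero Mc G by blast
  next
    assume "M = G"
    moreover have "frob_norm G \<le> frob_norm X" if "X \<in> carrier_mat p q" "f X = f G" for X
      using pyth[OF that] frob_inner_nonneg[of "X - G"] by (simp add: frob_norm_def)
    ultimately show "min_norm_solution p q f V M" using G by (simp add: min_norm_solution_def lsq)
  qed
  moreover have "mp_inverse p q n m f V = G"
    unfolding G_def using f by (intro mp_inverse_eqI[OF _ g V]) (simp add: mat_linear_def)
  ultimately show ?thesis by simp
qed

section \<open>The operator of order \<open>K\<close>\<close>

text \<open>
  Matrix indices start at 0, while \<open>\<theta>\<close>, receivers \<open>r\<close> and orders \<open>m\<close> start at 1: row \<open>i\<close> is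
  receiver \<open>Suc i\<close>, and columns \<open>2 * (m - 1)\<close> and \<open>2 * (m - 1) + 1\<close> are the cosine and sine
  columns of order \<open>m\<close>.
\<close>

definition ord_of :: "nat \<Rightarrow> nat" where
  "ord_of j = Suc (j div 2)"

definition C_mat :: "(nat \<Rightarrow> real) \<Rightarrow> nat \<Rightarrow> nat \<Rightarrow> real mat" where
  "C_mat \<theta> N K = mat N (2 * K) (\<lambda>(i, j).
     if even j then cos (real (ord_of j) * \<theta> (Suc i)) else sin (real (ord_of j) * \<theta> (Suc i)))"

definition D_mat :: "real \<Rightarrow> nat \<Rightarrow> real mat" where
  "D_mat \<rho> K =
     (1 / (2 * pi)) \<cdot>\<^sub>m mat_diag (2 * K) (\<lambda>j. 1 / (real (ord_of j) * \<rho> ^ ord_of j))"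

definition L_op :: "(nat \<Rightarrow> real) \<Rightarrow> real \<Rightarrow> nat \<Rightarrow> nat \<Rightarrow> real mat \<Rightarrow> real mat" where
  "L_op \<theta> \<rho> N K M = C_mat \<theta> N K * D_mat \<rho> K * M * D_mat \<rho> K * transpose_mat (C_mat \<theta> N K)"

definition L_pinv :: "(nat \<Rightarrow> real) \<Rightarrow> real \<Rightarrow> nat \<Rightarrow> nat \<Rightarrow> real mat \<Rightarrow> real mat" where
  "L_pinv \<theta> \<rho> N K = mp_inverse (2 * K) (2 * K) N N (L_op \<theta> \<rho> N K)"

end

theory Submission
  imports Defs
begin

text \<open>
  The operator of order \<open>K\<close> is the two-sided product \<open>M \<mapsto> A M A\<^sup>T\<close> with \<open>A = C D\<close>, because \<open>D\<close> is
  symmetric. If \<open>P\<close> is the pseudo-inverse of the matrix \<open>A\<close>, then \<open>V \<mapsto> P V P\<^sup>T\<close> is the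
  pseudo-inverse of this operator: the Penrose conditions for the operator reduce to those for
  \<open>A\<close> and \<open>P\<close> (lemma \<open>is_mp_inverse_two_sided_mult\<close>).

  At equispaced angles with \<open>2 K < N\<close>, any two orders \<open>m, n \<le> K\<close> satisfy \<open>0 < m + n < N\<close>, so no
  aliasing occurs and the cosine and sine columns of \<open>C\<close> are orthogonal with squared norm \<open>N / 2\<close>
  (lemma \<open>C_mat_columns_orthogonal\<close>). Hence \<open>C\<^sup>T C = (N / 2) I\<close> and \<open>P = (2 / N) D\<inverse> C\<^sup>T\<close>
  (lemma \<open>penrose_inverse_CD\<close>).

  In this formula row \<open>i\<close> of \<open>P\<close> involves only column \<open>i\<close> of \<open>C\<close> and entry \<open>i\<close> of the diagonal
  matrix \<open>D\<close>; it is the same for every order that has such a row. Entry \<open>(i, j)\<close> of \<open>P V P\<^sup>T\<close> uses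
  only rows \<open>i\<close> and \<open>j\<close> of \<open>P\<close>, so raising the order leaves the entries already present unchanged.
\<close>

section \<open>Pseudo-inverses of two-sided matrix products\<close>

definition penrose_inverse :: "real mat \<Rightarrow> real mat \<Rightarrow> bool" where
  "penrose_inverse A P \<longleftrightarrow>
     P \<in> carrier_mat (dim_col A) (dim_row A) \<and>
     A * P * A = A \<and> P * A * P = P \<and>
     transpose_mat (A * P) = A * P \<and> transpose_mat (P * A) = P * A"

lemma two_sided_mult_index:
  assumes "P \<in> carrier_mat p n" "Y \<in> carrier_mat n m" "Q \<in> carrier_mat q m" "i < p" "j < q"
  shows "(P * Y * transpose_mat Q) $$ (i,j) = (\<Sum>s<m. (row P i \<bullet> col Y s) * row Q j $ s)"
  using assms by (simp add: scalar_prod_def[of _ "row Q j"] atLeast0LessThan del: assoc_mult_mat)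

text \<open>
  An operator may be replaced by a formula for it that holds only on matrices of the right size.
\<close>

lemma is_mp_inverse_cong:
  assumes "is_mp_inverse p q n m f g" and "f \<in> carrier_mat p q \<rightarrow> carrier_mat n m"
    and "\<And>X. X \<in> carrier_mat p q \<Longrightarrow> f' X = f X"
  shows "is_mp_inverse p q n m f' g"
proof -
  have "\<And>Y. Y \<in> carrier_mat n m \<Longrightarrow> g Y \<in> carrier_mat p q"
    using assms(1) by (auto simp: is_mp_inverse_def mat_linear_def)
  moreover have "\<And>X. X \<in> carrier_mat p q \<Longrightarrow> f X \<in> carrier_mat n m"
    using assms(2) by auto
  ultimately show ?thesis
    using assms(1,3) by (simp add: is_mp_inverse_def self_adjoint_op_def)
qed

lemma two_sided_mult_comp:
  assumes "A \<in> carrier_mat n p" "P \<in> carrier_mat p l" "X \<in> carrier_mat l k"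
    "Q \<in> carrier_mat q k" "B \<in> carrier_mat m q"
  shows "A * (P * X * transpose_mat Q) * transpose_mat B
    = (A * P) * X * transpose_mat (B * (Q :: real mat))"
proof -
  have "A * (P * X * transpose_mat Q) = A * P * X * transpose_mat Q"
    using assms
    by (simp add: assoc_mult_mat[of A n p "P * X" k "transpose_mat Q" q]
        assoc_mult_mat[of A n p P l X k])
  moreover have "A * P * X * transpose_mat Q * transpose_mat B
      = A * P * X * (transpose_mat Q * transpose_mat B)"
  proof (rule assoc_mult_mat)
    show "A * P * X \<in> carrier_mat n k" using assms(1-3) by auto
    show "transpose_mat Q \<in> carrier_mat k q" using assms(4) by simp
    show "transpose_mat B \<in> carrier_mat q m" using assms(5) by simp
  qed
  ultimately show ?thesis by (simp only: transpose_mult[OF assms(5,4)])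
qed

lemma frob_inner_mult_left:
  assumes "S \<in> carrier_mat n p" "X \<in> carrier_mat p q" "Y \<in> carrier_mat n q"
  shows "frob_inner (S * X) Y = frob_inner X (transpose_mat S * Y)"
proof -
  have "frob_inner (S * X) Y = (\<Sum>i<n. \<Sum>j<q. \<Sum>l<p. S $$ (i,l) * X $$ (l,j) * Y $$ (i,j))"
    using assms by (simp add: frob_inner_def scalar_prod_def sum_distrib_right atLeast0LessThan)
  also have "\<dots> = (\<Sum>j<q. \<Sum>i<n. \<Sum>l<p. S $$ (i,l) * X $$ (l,j) * Y $$ (i,j))"
    by (rule sum.swap)
  also have "\<dots> = (\<Sum>j<q. \<Sum>l<p. \<Sum>i<n. S $$ (i,l) * X $$ (l,j) * Y $$ (i,j))"
    by (intro sum.cong refl sum.swap)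
  also have "\<dots> = (\<Sum>l<p. \<Sum>j<q. \<Sum>i<n. S $$ (i,l) * X $$ (l,j) * Y $$ (i,j))"
    by (rule sum.swap)
  also have "\<dots> = frob_inner X (transpose_mat S * Y)"
    using assms by (simp add: frob_inner_def scalar_prod_def sum_distrib_left atLeast0LessThan ac_simps)
  finally show ?thesis .
qed

lemma frob_inner_mult_right:
  assumes "X \<in> carrier_mat p q" "T \<in> carrier_mat q m" "Y \<in> carrier_mat p m"
  shows "frob_inner (X * T) Y = frob_inner X (Y * transpose_mat T)"
proof -
  have "frob_inner (X * T) Y = (\<Sum>i<p. \<Sum>j<m. \<Sum>l<q. X $$ (i,l) * T $$ (l,j) * Y $$ (i,j))"
    using assms by (simp add: frob_inner_def scalar_prod_def sum_distrib_right atLeast0LessThan)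
  also have "\<dots> = (\<Sum>i<p. \<Sum>l<q. \<Sum>j<m. X $$ (i,l) * T $$ (l,j) * Y $$ (i,j))"
    by (intro sum.cong refl sum.swap)
  also have "\<dots> = frob_inner X (Y * transpose_mat T)"
    using assms by (simp add: frob_inner_def scalar_prod_def sum_distrib_left atLeast0LessThan ac_simps)
  finally show ?thesis .
qed

text \<open>
  Left and right factors move across the Frobenius inner product as their transposes, so symmetric
  factors on both sides give a self-adjoint operator. This covers the last two Penrose conditions.
\<close>

lemma self_adjoint_two_sided_mult:
  assumes S: "S \<in> carrier_mat p p" "transpose_mat S = S"
    and T: "T \<in> carrier_mat q q" "transpose_mat T = T"
  shows "self_adjoint_op p q (\<lambda>X. S * X * transpose_mat T)"
  unfolding self_adjoint_op_def
proof (intro ballI)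
  fix X Y :: "real mat" assume X: "X \<in> carrier_mat p q" and Y: "Y \<in> carrier_mat p q"
  have "frob_inner (S * X * T) Y = frob_inner (S * X) (Y * T)"
    using frob_inner_mult_right[of "S * X" p q T q Y] S T X Y by simp
  also have "\<dots> = frob_inner X (S * (Y * T))"
    using frob_inner_mult_left[of S p p X q "Y * T"] S T X Y by simp
  also have "S * (Y * T) = S * Y * T"
    using S T Y by (simp add: assoc_mult_mat[of S p p Y q T q])
  finally show "frob_inner (S * X * transpose_mat T) Y = frob_inner X (S * Y * transpose_mat T)"
    by (simp add: T)
qed

lemma mat_linear_two_sided_mult:
  assumes A: "A \<in> carrier_mat n p" and B: "B \<in> carrier_mat m q"
  shows "mat_linear p q n m (\<lambda>X. A * X * transpose_mat B)"
  unfolding mat_linear_def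
proof (intro conjI ballI allI)
  show "(\<lambda>X. A * X * transpose_mat B) \<in> carrier_mat p q \<rightarrow> carrier_mat n m"
    using A B by auto
next
  fix X Y :: "real mat" assume "X \<in> carrier_mat p q" "Y \<in> carrier_mat p q"
  then show "A * (X + Y) * transpose_mat B = A * X * transpose_mat B + A * Y * transpose_mat B"
    using A B by (simp add: mult_add_distrib_mat[of A n p] add_mult_distrib_mat[of "A * X" n q])
next
  fix c :: real and X :: "real mat" assume "X \<in> carrier_mat p q"
  then show "A * (c \<cdot>\<^sub>m X) * transpose_mat B = c \<cdot>\<^sub>m (A * X * transpose_mat B)"
    using A B by (simp add: mult_smult_distrib[of A n p] mult_smult_assoc_mat[of "A * X" n q])
qed

text \<open>
  Composing two two-sided products multiplies the left and the right factors separately, so each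
  Penrose condition for the operators splits into the conditions for \<open>A, P\<close> on the left and for
  \<open>B, Q\<close> on the right. In terms of Kronecker products: the pseudo-inverse of \<open>A \<otimes> B\<close> is the
  Kronecker product of the pseudo-inverses.
\<close>

lemma is_mp_inverse_two_sided_mult:
  assumes A: "A \<in> carrier_mat n p" and B: "B \<in> carrier_mat m q"
    and P: "penrose_inverse A P" and Q: "penrose_inverse B Q"
  shows "is_mp_inverse p q n m (\<lambda>X. A * X * transpose_mat B) (\<lambda>Y. P * Y * transpose_mat Q)"
proof -
  have Pc: "P \<in> carrier_mat p n" and Qc: "Q \<in> carrier_mat q m"
    using A B P Q by (auto simp: penrose_inverse_def)
  have fg: "A * (P * Y * transpose_mat Q) * transpose_mat B = A * P * Y * transpose_mat (B * Q)"
    if "Y \<in> carrier_mat n m" for Y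
    by (rule two_sided_mult_comp[OF A Pc that Qc B])
  have gf: "P * (A * X * transpose_mat B) * transpose_mat Q = P * A * X * transpose_mat (Q * B)"
    if "X \<in> carrier_mat p q" for X
    by (rule two_sided_mult_comp[OF Pc A that B Qc])
  have "A * (P * (A * X * transpose_mat B) * transpose_mat Q) * transpose_mat B
      = A * X * transpose_mat B" if X: "X \<in> carrier_mat p q" for X
  proof -
    have "A * (P * (A * X * transpose_mat B) * transpose_mat Q) * transpose_mat B
        = A * P * (A * X * transpose_mat B) * transpose_mat (B * Q)"
      using A B X by (intro fg) auto
    also have "\<dots> = A * P * A * X * transpose_mat (B * Q * B)"
      using A B Pc Qc X by (intro two_sided_mult_comp[where n = n and p = n and m = m and q = m]) auto
    finally show ?thesis using P Q by (simp only: penrose_inverse_def)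
  qed
  moreover have "P * (A * (P * Y * transpose_mat Q) * transpose_mat B) * transpose_mat Q
      = P * Y * transpose_mat Q" if Y: "Y \<in> carrier_mat n m" for Y
  proof -
    have "P * (A * (P * Y * transpose_mat Q) * transpose_mat B) * transpose_mat Q
        = P * A * (P * Y * transpose_mat Q) * transpose_mat (Q * B)"
      using Pc Qc Y by (intro gf) auto
    also have "\<dots> = P * A * P * Y * transpose_mat (Q * B * Q)"
      using A B Pc Qc Y by (intro two_sided_mult_comp[where n = p and p = p and m = q and q = q]) auto
    finally show ?thesis using P Q by (simp only: penrose_inverse_def)
  qed
  moreover have "self_adjoint_op n m (\<lambda>Y. A * P * Y * transpose_mat (B * Q))"
    using A B P Q Pc Qc by (intro self_adjoint_two_sided_mult) (auto simp: penrose_inverse_def)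
  moreover have "self_adjoint_op p q (\<lambda>X. P * A * X * transpose_mat (Q * B))"
    using A B P Q Pc Qc by (intro self_adjoint_two_sided_mult) (auto simp: penrose_inverse_def)
  ultimately show ?thesis
    unfolding is_mp_inverse_def
    using mat_linear_two_sided_mult[OF Pc Qc] by (simp add: self_adjoint_op_def fg gf)
qed

section \<open>Discrete orthogonality of the trigonometric system\<close>

text \<open>
  The summands are the powers \<open>z, \<dots>, z ^ N\<close> of an \<open>N\<close>-th root of unity \<open>z\<close>, and \<open>z \<noteq> 1\<close> because
  \<open>N\<close> does not divide \<open>k\<close>; the geometric sum vanishes.
\<close>

lemma sum_cis_equispaced:
  fixes k :: int
  assumes "N \<ge> 1" and "\<not> int N dvd k"
  shows "(\<Sum>r<N. cis (real_of_int k * (2 * pi * real (Suc r) / real N))) = 0"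
proof -
  define z where "z = cis (2 * pi * real_of_int k / real N)"
  have "z \<noteq> 1"
  proof
    assume "z = 1"
    then have "cos (2 * pi * real_of_int k / real N) = 1"
      unfolding z_def by (metis cis.simps(1) one_complex.simps(1))
    then obtain l :: int where "2 * pi * real_of_int k / real N = real_of_int l * 2 * pi"
      by (auto simp: cos_one_2pi_int)
    then have "real_of_int k = real_of_int (l * int N)"
      using assms(1) by (simp add: field_simps)
    then have "k = l * int N" by linarith
    then show False using assms(2) by simp
  qed
  have "z ^ N = cis (2 * pi * real_of_int k)"
    using assms(1) by (simp add: z_def DeMoivre)
  also have "\<dots> = 1" by (rule cis_multiple_2pi) simp
  finally have "z ^ N = 1" .
  have "cis (real_of_int k * (2 * pi * real (Suc r) / real N)) = z * z ^ r" for r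
    unfolding power_Suc[symmetric] by (simp add: z_def DeMoivre mult_ac del: of_nat_Suc power_Suc)
  then have "(\<Sum>r<N. cis (real_of_int k * (2 * pi * real (Suc r) / real N))) = z * (\<Sum>r<N. z ^ r)"
    by (simp only: sum_distrib_left)
  also have "\<dots> = 0"
    unfolding geometric_sum[OF \<open>z \<noteq> 1\<close>] by (simp add: \<open>z ^ N = 1\<close>)
  finally show ?thesis .
qed

lemma sum_cos_sin_equispaced:
  fixes k :: int
  assumes "N \<ge> 1" and "\<bar>k\<bar> < int N"
  shows "(\<Sum>r<N. cos (real_of_int k * (2 * pi * real (Suc r) / real N))) = (if k = 0 then real N else 0)"
    and "(\<Sum>r<N. sin (real_of_int k * (2 * pi * real (Suc r) / real N))) = 0"
proof -
  have "\<not> int N dvd k" if "k \<noteq> 0"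
    using dvd_imp_le_int[OF that, of "int N"] assms(2) by auto
  then have "(\<Sum>r<N. cis (real_of_int k * (2 * pi * real (Suc r) / real N))) = 0" if "k \<noteq> 0"
    using that assms(1) by (intro sum_cis_equispaced) auto
  then have "Re (\<Sum>r<N. cis (real_of_int k * (2 * pi * real (Suc r) / real N))) = 0"
    "Im (\<Sum>r<N. cis (real_of_int k * (2 * pi * real (Suc r) / real N))) = 0" if "k \<noteq> 0"
    using that by simp_all
  then show "(\<Sum>r<N. cos (real_of_int k * (2 * pi * real (Suc r) / real N))) = (if k = 0 then real N else 0)"
    and "(\<Sum>r<N. sin (real_of_int k * (2 * pi * real (Suc r) / real N))) = 0"
    by (cases "k = 0"; simp del: of_nat_Suc)+
qed

locale circular_array =
  fixes N :: nat and \<theta> :: "nat \<Rightarrow> real" and \<rho> :: real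
  assumes N_pos: "N \<ge> 1"
    and angles: "\<And>s. s \<in> {1..N} \<Longrightarrow> \<theta> s = 2 * pi * real s / real N"
    and rho_pos: "\<rho> > 0"
begin

lemma sum_cos_sin_angles:
  fixes k :: int
  assumes "\<bar>k\<bar> < int N"
  shows "(\<Sum>r<N. cos (real_of_int k * \<theta> (Suc r))) = (if k = 0 then real N else 0)"
    and "(\<Sum>r<N. sin (real_of_int k * \<theta> (Suc r))) = 0"
proof -
  have "\<theta> (Suc r) = 2 * pi * real (Suc r) / real N" if "r < N" for r
    using that by (intro angles) auto
  then show "(\<Sum>r<N. cos (real_of_int k * \<theta> (Suc r))) = (if k = 0 then real N else 0)"
    and "(\<Sum>r<N. sin (real_of_int k * \<theta> (Suc r))) = 0"
    using sum_cos_sin_equispaced[OF N_pos assms] by (simp_all del: of_nat_Suc)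
qed

text \<open>
  The product-to-sum formulas turn each inner product into half a sum or difference of the sums at
  the frequencies \<open>m - n\<close> and \<open>m + n\<close>. Since \<open>2 K < N\<close>, both lie strictly between \<open>- N\<close> and \<open>N\<close>,
  and \<open>m + n \<noteq> 0\<close>; only a cosine sum with \<open>m = n\<close> survives.
\<close>

lemma C_mat_columns_orthogonal:
  assumes K: "2 * K < N" and i: "i < 2 * K" and j: "j < 2 * K"
  shows "(\<Sum>r<N. C_mat \<theta> N K $$ (r,i) * C_mat \<theta> N K $$ (r,j)) = (if i = j then real N / 2 else 0)"
proof -
  define m n where "m = int (ord_of i)" and "n = int (ord_of j)"
  have mn: "\<bar>m - n\<bar> < int N" "\<bar>m + n\<bar> < int N" "m + n \<noteq> 0"
  proof -
    have "i div 2 < K" "j div 2 < K" using i j by auto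
    then show "\<bar>m - n\<bar> < int N" "\<bar>m + n\<bar> < int N" "m + n \<noteq> 0"
      using K unfolding m_def n_def ord_of_def by linarith+
  qed
  have ij: "i = j \<longleftrightarrow> m = n \<and> (even i \<longleftrightarrow> even j)"
    by (auto simp: m_def n_def ord_of_def) (metis even_two_times_div_two odd_two_times_div_two_succ)
  note sums = sum_cos_sin_angles[OF mn(1)] sum_cos_sin_angles[OF mn(2)]
  have C: "C_mat \<theta> N K $$ (r,i) = (if even i then cos (real_of_int m * \<theta> (Suc r)) else sin (real_of_int m * \<theta> (Suc r)))"
    "C_mat \<theta> N K $$ (r,j) = (if even j then cos (real_of_int n * \<theta> (Suc r)) else sin (real_of_int n * \<theta> (Suc r)))"
    if "r < N" for r
    using that i j by (auto simp: C_mat_def m_def n_def)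
  have "(\<Sum>r<N. C_mat \<theta> N K $$ (r,i) * C_mat \<theta> N K $$ (r,j)) =
    (\<Sum>r<N. (if even i then cos (real_of_int m * \<theta> (Suc r)) else sin (real_of_int m * \<theta> (Suc r)))
       * (if even j then cos (real_of_int n * \<theta> (Suc r)) else sin (real_of_int n * \<theta> (Suc r))))"
    by (intro sum.cong refl) (simp add: C)
  also have "\<dots> = (if i = j then real N / 2 else 0)"
    using sums mn(3) unfolding ij
    by (cases "even i"; cases "even j")
      (auto simp: cos_times_cos sin_times_sin cos_times_sin sin_times_cos
         sum_divide_distrib[symmetric] sum.distrib sum_subtractf
         left_diff_distrib distrib_right)
  finally show ?thesis .
qed

section \<open>The pseudo-inverse in closed form\<close>

text \<open>Diagonal entry \<open>i\<close> of \<open>D\<close>, which is common to all orders for which \<open>D\<close> has this entry.\<close>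

definition D_weight :: "nat \<Rightarrow> real" where
  "D_weight i = 1 / (2 * pi * (real (ord_of i) * \<rho> ^ ord_of i))"

definition CD_mat :: "nat \<Rightarrow> real mat" where
  "CD_mat K = C_mat \<theta> N K * D_mat \<rho> K"

text \<open>
  This is \<open>(2 / N) D\<inverse> C\<^sup>T\<close>, written by entries so that the independence of each row from \<open>K\<close> is
  visible.
\<close>

definition CD_pinv :: "nat \<Rightarrow> real mat" where
  "CD_pinv K = mat (2 * K) N (\<lambda>(i, r). 2 / (real N * D_weight i) * C_mat \<theta> N K $$ (r,i))"

lemma D_weight_pos: "D_weight i > 0"
  using rho_pos by (simp add: D_weight_def ord_of_def)

lemma CD_mat_carrier: "CD_mat K \<in> carrier_mat N (2 * K)"
  and CD_pinv_carrier: "CD_pinv K \<in> carrier_mat (2 * K) N"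
proof -
  have "C_mat \<theta> N K \<in> carrier_mat N (2 * K)" "D_mat \<rho> K \<in> carrier_mat (2 * K) (2 * K)"
    by (simp_all add: C_mat_def D_mat_def)
  then show "CD_mat K \<in> carrier_mat N (2 * K)" unfolding CD_mat_def by (rule mult_carrier_mat)
  show "CD_pinv K \<in> carrier_mat (2 * K) N" by (simp add: CD_pinv_def)
qed

lemma CD_mat_index:
  assumes "r < N" "i < 2 * K"
  shows "CD_mat K $$ (r,i) = D_weight i * C_mat \<theta> N K $$ (r,i)"
proof -
  have C: "C_mat \<theta> N K \<in> carrier_mat N (2 * K)" by (simp add: C_mat_def)
  show ?thesis
    using assms C
    by (simp add: CD_mat_def D_mat_def mult_smult_distrib[OF C mat_diag_dim]
        mat_diag_mult_right[OF C] D_weight_def)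
qed

lemma CD_pinv_left_inverse:
  assumes K: "2 * K < N"
  shows "CD_pinv K * CD_mat K = 1\<^sub>m (2 * K)"
proof (rule eq_matI)
  fix i j assume "i < dim_row (1\<^sub>m (2 * K) :: real mat)" "j < dim_col (1\<^sub>m (2 * K) :: real mat)"
  then have ij: "i < 2 * K" "j < 2 * K" by auto
  have "(CD_pinv K * CD_mat K) $$ (i,j) = (\<Sum>r<N. CD_pinv K $$ (i,r) * CD_mat K $$ (r,j))"
    using ij CD_mat_carrier[of K] CD_pinv_carrier[of K] by (simp add: scalar_prod_def atLeast0LessThan)
  also have "\<dots> = (\<Sum>r<N. 2 * D_weight j / (real N * D_weight i)
        * (C_mat \<theta> N K $$ (r,i) * C_mat \<theta> N K $$ (r,j)))"
    using ij by (intro sum.cong refl) (simp add: CD_mat_index CD_pinv_def)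
  also have "\<dots> = 2 * D_weight j / (real N * D_weight i) * (if i = j then real N / 2 else 0)"
    unfolding sum_distrib_left[symmetric] C_mat_columns_orthogonal[OF K ij] by (rule refl)
  also have "\<dots> = 1\<^sub>m (2 * K) $$ (i,j)"
    using ij D_weight_pos[of i] N_pos by auto
  finally show "(CD_pinv K * CD_mat K) $$ (i,j) = 1\<^sub>m (2 * K) $$ (i,j)" .
qed (use CD_mat_carrier[of K] CD_pinv_carrier[of K] in auto)

text \<open>
  The weights of \<open>D\<close> cancel between the two factors, leaving \<open>(2 / N) C C\<^sup>T\<close>.
\<close>

lemma CD_range_projection_symmetric: "transpose_mat (CD_mat K * CD_pinv K) = CD_mat K * CD_pinv K"
proof -
  have *: "(CD_mat K * CD_pinv K) $$ (r,s)
      = (\<Sum>i<2*K. 2 / real N * (C_mat \<theta> N K $$ (r,i) * C_mat \<theta> N K $$ (s,i)))"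
    if "r < N" "s < N" for r s
  proof -
    have "(CD_mat K * CD_pinv K) $$ (r,s) = (\<Sum>i<2*K. CD_mat K $$ (r,i) * CD_pinv K $$ (i,s))"
      using that CD_mat_carrier[of K] CD_pinv_carrier[of K] by (simp add: scalar_prod_def atLeast0LessThan)
    also have "\<dots> = (\<Sum>i<2*K. 2 / real N * (C_mat \<theta> N K $$ (r,i) * C_mat \<theta> N K $$ (s,i)))"
      using that D_weight_pos
      by (intro sum.cong refl) (simp add: CD_mat_index CD_pinv_def less_imp_neq[symmetric])
    finally show ?thesis .
  qed
  show ?thesis
    by (rule eq_matI) (use CD_mat_carrier[of K] CD_pinv_carrier[of K] in \<open>auto simp: * mult.commute simp del: index_mult_mat(1)\<close>)
qed

lemma penrose_inverse_CD:
  assumes "2 * K < N"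
  shows "penrose_inverse (CD_mat K) (CD_pinv K)"
proof -
  have "CD_mat K * CD_pinv K * CD_mat K = CD_mat K * (CD_pinv K * CD_mat K)"
    using assoc_mult_mat[OF CD_mat_carrier CD_pinv_carrier CD_mat_carrier] .
  then show ?thesis
    using CD_mat_carrier[of K] CD_pinv_carrier[of K]
    by (simp add: penrose_inverse_def CD_pinv_left_inverse[OF assms] CD_range_projection_symmetric)
qed

lemma L_op_two_sided_mult:
  assumes "M \<in> carrier_mat (2 * K) (2 * K)"
  shows "L_op \<theta> \<rho> N K M = CD_mat K * M * transpose_mat (CD_mat K)"
proof -
  have C: "C_mat \<theta> N K \<in> carrier_mat N (2 * K)" and D: "D_mat \<rho> K \<in> carrier_mat (2 * K) (2 * K)"
    by (auto simp: C_mat_def D_mat_def)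
  have "transpose_mat (D_mat \<rho> K) = D_mat \<rho> K"
    by (rule eq_matI) (auto simp: D_mat_def mat_diag_def)
  then have T: "transpose_mat (CD_mat K) = D_mat \<rho> K * transpose_mat (C_mat \<theta> N K)"
    using C D by (simp add: CD_mat_def transpose_mult)
  have "CD_mat K * M * D_mat \<rho> K * transpose_mat (C_mat \<theta> N K)
      = CD_mat K * M * (D_mat \<rho> K * transpose_mat (C_mat \<theta> N K))"
    by (rule assoc_mult_mat[where ?n\<^sub>1 = N and ?n\<^sub>2 = "2 * K" and ?n\<^sub>3 = "2 * K" and ?n\<^sub>4 = N])
      (use C D CD_mat_carrier[of K] assms in auto)
  then show ?thesis unfolding T by (simp only: L_op_def CD_mat_def)
qed

lemma L_pinv_closed_form:
  assumes K: "2 * K < N" and V: "V \<in> carrier_mat N N"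
  shows "L_pinv \<theta> \<rho> N K V = CD_pinv K * V * transpose_mat (CD_pinv K)"
proof -
  let ?L = "L_op \<theta> \<rho> N K" and ?G = "\<lambda>Y. CD_pinv K * Y * transpose_mat (CD_pinv K)"
  have "is_mp_inverse (2 * K) (2 * K) N N (\<lambda>X. CD_mat K * X * transpose_mat (CD_mat K)) ?G"
    using CD_mat_carrier penrose_inverse_CD[OF K] by (intro is_mp_inverse_two_sided_mult)
  then have g: "is_mp_inverse (2 * K) (2 * K) N N ?L ?G"
    by (rule is_mp_inverse_cong) (use CD_mat_carrier[of K] in \<open>auto simp: L_op_two_sided_mult\<close>)
  have f: "?L \<in> carrier_mat (2 * K) (2 * K) \<rightarrow> carrier_mat N N"
    using CD_mat_carrier[of K] by (auto simp: L_op_two_sided_mult)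
  show ?thesis
    unfolding L_pinv_def by (rule mp_inverse_eqI[OF f g V])
qed

text \<open>The reason why the solutions of different orders are nested.\<close>

lemma row_CD_pinv_order_independent:
  assumes "i < 2 * K\<^sub>1" and "K\<^sub>1 \<le> K\<^sub>2"
  shows "row (CD_pinv K\<^sub>2) i = row (CD_pinv K\<^sub>1) i"
  using assms by (intro eq_vecI) (auto simp: CD_pinv_def C_mat_def)

end

section \<open>Leading submatrices of the minimal norm solutions\<close>

lemma pick_lessThan: "i < n \<Longrightarrow> pick {..<n} i = i"
proof -
  assume "i < n"
  then have "{a \<in> {..<n}. a < i} = {..<i}" by auto
  then show ?thesis using pick_card_in_set[of i "{..<n}"] \<open>i < n\<close> by simp
qed

lemma submatrix_leading_index:
  assumes "A \<in> carrier_mat p p" and "n \<le> p"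
  shows "submatrix A {..<n} {..<n} \<in> carrier_mat n n"
    and "i < n \<Longrightarrow> j < n \<Longrightarrow> submatrix A {..<n} {..<n} $$ (i,j) = A $$ (i,j)"
proof -
  have "{i. i < p \<and> i \<in> {..<n}} = {..<n}" using assms by auto
  then have card: "card {i. i < dim_row A \<and> i \<in> {..<n}} = n"
    "card {j. j < dim_col A \<and> j \<in> {..<n}} = n" using assms by auto
  then show "submatrix A {..<n} {..<n} \<in> carrier_mat n n"
    by (intro carrier_matI) (simp_all only: dim_submatrix)
  show "i < n \<Longrightarrow> j < n \<Longrightarrow> submatrix A {..<n} {..<n} $$ (i,j) = A $$ (i,j)"
    by (subst submatrix_index) (simp_all only: card pick_lessThan)
qed

theorem proposition2p3:
  fixes N K\<^sub>1 K\<^sub>2 :: nat and \<rho> :: real and \<theta> :: "nat \<Rightarrow> real" and V :: "real mat"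
  assumes "N \<ge> 1"
    and "\<rho> > 1"
    and "\<And>s. s \<in> {1..N} \<Longrightarrow> \<theta> s = 2 * pi * real s / real N"
    and "1 \<le> K\<^sub>1" and "K\<^sub>1 \<le> K\<^sub>2" and "real K\<^sub>2 < real N / 2"
    and "V \<in> carrier_mat N N"
  shows "submatrix (L_pinv \<theta> \<rho> N K\<^sub>2 V) {..<2 * K\<^sub>1} {..<2 * K\<^sub>1} = L_pinv \<theta> \<rho> N K\<^sub>1 V"
proof -
  interpret circular_array N \<theta> \<rho>
    using assms(1-3) by unfold_locales auto
  have K: "2 * K\<^sub>1 < N" "2 * K\<^sub>2 < N" "2 * K\<^sub>1 \<le> 2 * K\<^sub>2" using assms(5,6) by auto
  have carr: "L_pinv \<theta> \<rho> N K V \<in> carrier_mat (2 * K) (2 * K)" if "2 * K < N" for K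
    unfolding L_pinv_closed_form[OF that assms(7)] using CD_pinv_carrier[of K] assms(7) by auto
  note sub = submatrix_leading_index[OF carr[OF K(2)] K(3)]
  show ?thesis
  proof (rule eq_matI)
    fix i j assume "i < dim_row (L_pinv \<theta> \<rho> N K\<^sub>1 V)" "j < dim_col (L_pinv \<theta> \<rho> N K\<^sub>1 V)"
    then have ij: "i < 2 * K\<^sub>1" "j < 2 * K\<^sub>1" using carr[OF K(1)] by auto
    then have "i < 2 * K\<^sub>2" "j < 2 * K\<^sub>2" using K(3) by auto
    then show "submatrix (L_pinv \<theta> \<rho> N K\<^sub>2 V) {..<2 * K\<^sub>1} {..<2 * K\<^sub>1} $$ (i,j)
        = L_pinv \<theta> \<rho> N K\<^sub>1 V $$ (i,j)"
      using ij K(1,2) assms(5,7) unfolding sub(2)[OF ij]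
      by (simp only: L_pinv_closed_form two_sided_mult_index[OF CD_pinv_carrier _ CD_pinv_carrier]
          row_CD_pinv_order_independent[of _ K\<^sub>1 K\<^sub>2])
  qed (use sub(1) carr[OF K(1)] in auto)
qed

end
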